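(* For non-negative integers $N,i,j$ with $N\ge i,j$ and $\mu\in\{0,1,2\}$: $$[t^iu^j]P_{3N+\mu}(0,t,u,0;q)=q^{\omega(1,i,j)}\big((\delta_{0\mu}+\delta_{1\mu})F_N(i,j;q)+\delta_{2\mu}G_N(i,j;q)\big),$$ $$[s^iv^j]P_{3N+\mu}(s,0,0,v;q)=q^{\omega(2,i,j)}\big(\delta_{0\mu}F_N(i,j;q)+(\delta_{1\mu}+\delta_{2\mu})G_N(i,j;q)\big),$$ $$[s^iu^j]P_{3N+\mu}(s,0,u,0;q)=q^{\pi(1,i,j)}\big(\delta_{0\mu}F_N(i,j;q)+(\delta_{1\mu}+\delta_{2\mu})G_N(i,j;q)\big),$$ $$[t^iv^j]P_{3N+\mu}(0,t,0,v;q)=q^{\pi(2,i,j)}\big((\delta_{0\mu}+\delta_{1\mu})F_N(i,j;q)+\delta_{2\mu}G_N(i,j;q)\big).$$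
   Context: For $M\ge0$, $\mathcal{DS}^3_{M,\infty}$ is the set of partitions into distinct parts with largest part $\le M$ in which for no $l\ge0$ are both $3l+1$ and $3l+2$ parts. For $\pi=(\pi_1>\pi_2>\cdots)$ and $r=1,2$, $o_r(\pi)$ (resp. $e_r(\pi)$) is the number of odd-indexed parts $\pi_1,\pi_3,\dots$ (resp. even-indexed parts $\pi_2,\pi_4,\dots$) that are $\equiv r\pmod3$. $P_M(s,t,u,v;q)=\sum_{\pi\in\mathcal{DS}^3_{M,\infty}}s^{o_1(\pi)}t^{o_2(\pi)}u^{e_1(\pi)}v^{e_2(\pi)}q^{|\pi|}$, $|\pi|$ the sum of parts. $[x^iy^j]p(x,y)$ denotes the coefficient of $x^iy^j$; $\delta$ is the Kronecker delta. For $m\in\{1,2\}$: $\omega(m,i,j)=(3i-m)i+(3j+m)j$ and $\pi(m,i,j)=\omega(m,i,j)+(-1)^mi$. $F_N(i,j;q)=\begin{bmatrix}N\\ i,j,N-i-j\end{bmatrix}_{q^6}(-q^3;q^3)_{N-i-j}$ and $G_N(i,j;q)=\frac{1-q^{3(N+1+i-j)}}{1-q^{6(N+1)}}F_{N+1}(i,j;q)$, where $\begin{bmatrix}N\\ n_1,\dots,n_m\end{bmatrix}_q=\frac{(q;q)_N}{(q;q)_{n_1}\cdots(q;q)_{n_m}}$ (interpreted as $0$ if some index is negative) and $(x;q)_n=\prod_{k=1}^n(1-xq^{k-1})$. *)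

theory Defs
  imports "HOL-Computational_Algebra.Computational_Algebra"
begin

section \<open>The partitions and their generating function\<close>

text \<open>
  A partition into distinct parts is the strictly decreasing list of its parts.
  The list index starts at 0, so the odd-indexed parts \<open>\<pi>\<^sub>1, \<pi>\<^sub>3, \<dots>\<close> are those at even list positions.
\<close>

definition DS3 :: "nat \<Rightarrow> nat list set" where
  "DS3 M = {xs. sorted_wrt (>) xs \<and> set xs \<subseteq> {1..M} \<and>
                (\<nexists>l. 3 * l + 1 \<in> set xs \<and> 3 * l + 2 \<in> set xs)}"

definition odd_count :: "nat \<Rightarrow> nat list \<Rightarrow> nat" where
  "odd_count r xs = card {k. k < length xs \<and> even k \<and> xs ! k mod 3 = r}"

definition even_count :: "nat \<Rightarrow> nat list \<Rightarrow> nat" where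
  "even_count r xs = card {k. k < length xs \<and> odd k \<and> xs ! k mod 3 = r}"

definition P :: "nat \<Rightarrow> 'a \<Rightarrow> 'a \<Rightarrow> 'a \<Rightarrow> 'a \<Rightarrow> 'a \<Rightarrow> 'a::comm_semiring_1" where
  "P M s t u v q = (\<Sum>xs\<in>DS3 M.
     s ^ odd_count 1 xs * t ^ odd_count 2 xs * u ^ even_count 1 xs * v ^ even_count 2 xs *
     q ^ sum_list xs)"

lemma finite_DS3: "finite (DS3 M)"
proof (rule finite_subset)
  have sorted: "sorted_wrt (>) xs \<Longrightarrow> distinct xs" for xs :: "nat list"
    by (induction xs) auto
  show "DS3 M \<subseteq> {xs. set xs \<subseteq> {1..M} \<and> distinct xs}"
    using sorted by (auto simp: DS3_def)
  show "finite {xs. set xs \<subseteq> {1..M} \<and> distinct xs}"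
    by (rule finite_subset_distinct) simp
qed

section \<open>Polynomials in two variables over the rational functions in \<open>q\<close>\<close>

text \<open>
  The indeterminate \<open>q\<close> lives in the field of fractions of \<open>\<int>[q]\<close>, which is \<open>\<rat>(q)\<close>.
  In \<open>\<rat>(q)[x][y]\<close> the inner polynomial variable is \<open>x\<close> and the outer one is \<open>y\<close>.
\<close>

type_synonym ratfun = "int poly fract"

definition qvar :: ratfun where
  "qvar = Fract [:0, 1:] 1"

definition var_x :: "'a::comm_semiring_1 poly poly" where
  "var_x = [:[:0, 1:]:]"

definition var_y :: "'a::comm_semiring_1 poly poly" where
  "var_y = [:0, 1:]"

definition const2 :: "'a::comm_semiring_1 \<Rightarrow> 'a poly poly" where
  "const2 c = [:[:c:]:]"

definition coeff2 :: "'a::comm_semiring_1 poly poly \<Rightarrow> nat \<Rightarrow> nat \<Rightarrow> 'a" where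
  "coeff2 p i j = coeff (coeff p j) i"

section \<open>Exponents and \<open>q\<close>-multinomial coefficients\<close>

definition omega :: "nat \<Rightarrow> nat \<Rightarrow> nat \<Rightarrow> int" where
  "omega m i j = (3 * int i - int m) * int i + (3 * int j + int m) * int j"

definition pi_exp :: "nat \<Rightarrow> nat \<Rightarrow> nat \<Rightarrow> int" where
  "pi_exp m i j = omega m i j + (-1) ^ m * int i"

definition qpoch :: "'a::comm_ring_1 \<Rightarrow> 'a \<Rightarrow> nat \<Rightarrow> 'a" where
  "qpoch x q n = (\<Prod>k=1..n. 1 - x * q ^ (k - 1))"

definition qmultinomial :: "'a::field \<Rightarrow> nat \<Rightarrow> int list \<Rightarrow> 'a" where
  "qmultinomial q N ns =
     (if \<exists>n\<in>set ns. n < 0 then 0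
      else qpoch q q N / (\<Prod>n\<leftarrow>ns. qpoch q q (nat n)))"

text \<open>
  If \<open>N < i + j\<close>, the truncated index of the last factor is harmless,
  because the multinomial coefficient vanishes.
\<close>

definition F :: "nat \<Rightarrow> nat \<Rightarrow> nat \<Rightarrow> 'a \<Rightarrow> 'a::field" where
  "F N i j q = qmultinomial (q ^ 6) N [int i, int j, int N - int i - int j] *
     qpoch (- (q ^ 3)) (q ^ 3) (nat (int N - int i - int j))"

definition G :: "nat \<Rightarrow> nat \<Rightarrow> nat \<Rightarrow> 'a \<Rightarrow> 'a::field" where
  "G N i j q = (1 - q powi (3 * (int N + 1 + int i - int j))) / (1 - q ^ (6 * (N + 1))) *
     F (N + 1) i j q"

end

theory Submission
  imports Defs
begin

text \<open>
  Removing the largest part of a partition exchanges the odd-indexed and the even-indexed parts.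
  When only one residue \<open>a\<close> is allowed at odd and one residue \<open>b\<close> at even indices, this gives
  recurrences for the coefficients at \<open>3N\<close> and \<open>3N + 2\<close> that couple \<open>(a, b)\<close> with \<open>(b, a)\<close>.
  With the common exponent \<open>3i\<^sup>2 - (3 - a)i + 3j\<^sup>2 + bj\<close>, which equals \<open>\<omega>\<close> or \<open>\<pi>\<close> in the four cases,
  all of them reduce to the same two identities
  \<open>G\<^sub>N(i,j) = F\<^sub>N(i,j) + q\<^bsup>3(N+1-i-j)\<^esup> F\<^sub>N(j,i-1)\<close> and
  \<open>F\<^bsub>N+1\<^esub>(i,j) = G\<^sub>N(i,j) + q\<^bsup>3(N+1+i-j)\<^esup> G\<^sub>N(j,i)\<close>.
\<close>

section \<open>Removing the largest part\<close>

lemma odd_count_Nil [simp]: "odd_count r [] = 0"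
  and even_count_Nil [simp]: "even_count r [] = 0"
  by (simp_all add: odd_count_def even_count_def)

text \<open>Prepending a part moves every position up by one, so parities are exchanged. The new
  head sits at position 0 and can only affect \<open>odd_count\<close>.\<close>

lemma even_count_Cons [simp]: "even_count r (x # xs) = odd_count r xs"
proof -
  have "{k. k < length (x # xs) \<and> odd k \<and> (x # xs) ! k mod 3 = r}
      = Suc ` {k. k < length xs \<and> even k \<and> xs ! k mod 3 = r}"
    by (auto simp: image_iff less_Suc_eq_0_disj)
  then show ?thesis
    by (simp add: odd_count_def even_count_def card_image)
qed

lemma odd_count_Cons [simp]:
  "odd_count r (x # xs) = of_bool (x mod 3 = r) + even_count r xs"
proof -
  have "{k. k < length (x # xs) \<and> even k \<and> (x # xs) ! k mod 3 = r}
      = (if x mod 3 = r then {0} else {}) \<union> Suc ` {k. k < length xs \<and> odd k \<and> xs ! k mod 3 = r}"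
    by (auto simp: image_iff less_Suc_eq_0_disj)
  then show ?thesis
    by (simp add: odd_count_def even_count_def card_image)
qed

text \<open>If \<open>Suc M = 3 * l + 2\<close>, the head forbids \<open>M = 3 * l + 1\<close>,
  which lowers the bound for the tail to \<open>M - 1\<close>. Otherwise a forbidden partner of the
  head could only be larger than the head, so the tail is unrestricted.\<close>

lemma Cons_in_DS3_iff:
  "Suc M # xs \<in> DS3 (Suc M) \<longleftrightarrow> xs \<in> DS3 (if Suc M mod 3 = 2 then M - 1 else M)"
proof -
  have sub: "sorted_wrt (>) (Suc M # xs) \<and> set (Suc M # xs) \<subseteq> {1..Suc M} \<longleftrightarrow>
      sorted_wrt (>) xs \<and> set xs \<subseteq> {1..M}"
    by (force simp: subset_iff)
  have eq: "Suc M # xs \<in> DS3 (Suc M) \<longleftrightarrow> sorted_wrt (>) xs \<and> set xs \<subseteq> {1..M} \<and>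
      (\<nexists>l. 3 * l + 1 \<in> set (Suc M # xs) \<and> 3 * l + 2 \<in> set (Suc M # xs))"
    using sub unfolding DS3_def mem_Collect_eq by blast
  show ?thesis
  proof (cases "Suc M mod 3 = 2")
    case True
    define l where "l = Suc M div 3"
    have l: "M = 3 * l + 1" using True unfolding l_def by presburger
    have "xs \<in> DS3 (3 * l) \<longleftrightarrow> sorted_wrt (>) xs \<and> set xs \<subseteq> {1..M} \<and>
        (\<nexists>l. 3 * l + 1 \<in> set (Suc M # xs) \<and> 3 * l + 2 \<in> set (Suc M # xs))"
      (is "?L \<longleftrightarrow> ?R")
    proof
      assume ?L
      then show ?R by (fastforce simp: DS3_def l subset_iff)
    next
      \<comment> \<open>With \<open>M\<close> excluded as the partner of the head, the tail is
        bounded by \<open>M - 1 = 3 * l\<close>.\<close>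
      assume R: ?R
      then have "M \<notin> set xs" by (auto simp: l)
      with R show ?L by (auto simp: DS3_def l subset_iff le_Suc_eq)
    qed
    then show ?thesis
      unfolding eq using True l by simp
  next
    case False
    have "(\<exists>l. 3 * l + 1 \<in> set (Suc M # xs) \<and> 3 * l + 2 \<in> set (Suc M # xs)) \<longleftrightarrow>
        (\<exists>l. 3 * l + 1 \<in> set xs \<and> 3 * l + 2 \<in> set xs)" if "set xs \<subseteq> {1..M}"
    proof -
      have "3 * l + 2 \<noteq> Suc M" for l using False by presburger
      moreover have "3 * l + 2 \<noteq> Suc M \<and> 3 * l + 2 \<notin> set xs" if "3 * l + 1 = Suc M" for l
        using \<open>set xs \<subseteq> {1..M}\<close> that by auto
      ultimately show ?thesis by (metis list.set_intros(2) set_ConsD)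
    qed
    with False show ?thesis
      unfolding eq by (auto simp: DS3_def)
  qed
qed

lemma DS3_0: "DS3 0 = {[]}"
  by (auto simp: DS3_def)

lemma DS3_Suc:
  "DS3 (Suc M) = DS3 M \<union> Cons (Suc M) ` DS3 (if Suc M mod 3 = 2 then M - 1 else M)"
proof (rule set_eqI)
  fix ys
  show "ys \<in> DS3 (Suc M) \<longleftrightarrow>
      ys \<in> DS3 M \<union> Cons (Suc M) ` DS3 (if Suc M mod 3 = 2 then M - 1 else M)"
  proof (cases "\<exists>xs. ys = Suc M # xs")
    case True
    moreover have "Suc M # xs \<notin> DS3 M" for xs
      by (auto simp: DS3_def)
    ultimately show ?thesis
      using Cons_in_DS3_iff by auto
  next
    case False
    have "ys \<in> DS3 (Suc M) \<longleftrightarrow> ys \<in> DS3 M"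
    proof (cases ys)
      case (Cons y zs)
      with False have "Suc M \<notin> set ys" if "sorted_wrt (>) ys" "set ys \<subseteq> {1..Suc M}"
        using that by fastforce
      then have "sorted_wrt (>) ys \<and> set ys \<subseteq> {1..Suc M} \<longleftrightarrow> sorted_wrt (>) ys \<and> set ys \<subseteq> {1..M}"
        by (fastforce simp: subset_iff le_Suc_eq)
      then show ?thesis
        unfolding DS3_def mem_Collect_eq by blast
    qed (auto simp: DS3_def)
    with False show ?thesis by auto
  qed
qed

lemma P_0: "P 0 s t u v q = 1"
  by (simp add: P_def DS3_0)

text \<open>Splits by whether \<open>Suc M\<close> is a part. Deleting it shifts the other
  positions, so \<open>(s, t)\<close> and \<open>(u, v)\<close> trade places in the second
  summand.\<close>

lemma P_Suc:
  "P (Suc M) s t u v q = P M s t u v q +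
     s ^ of_bool (Suc M mod 3 = 1) * t ^ of_bool (Suc M mod 3 = 2) * q ^ Suc M *
     P (if Suc M mod 3 = 2 then M - 1 else M) u v s t q"
proof -
  let ?D = "DS3 (if Suc M mod 3 = 2 then M - 1 else M)"
  have disj: "DS3 M \<inter> Cons (Suc M) ` ?D = {}"
    by (auto simp: DS3_def)
  show ?thesis
    unfolding P_def DS3_Suc
    by (simp only: sum.union_disjoint[OF finite_DS3 finite_imageI[OF finite_DS3] disj])
      (simp add: sum.reindex sum_distrib_left power_add mult_ac)
qed

section \<open>Coefficients in the four specializations\<close>

text \<open>For \<open>a, b\<close> in {1, 2} the factors \<open>of_bool\<close> keep one residue
  variable at odd and one at even indices and kill the others. One family for all four cases lets
  the recurrences close under swapping \<open>(a, b)\<close>.\<close>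

definition spec_coeff :: "nat \<Rightarrow> nat \<Rightarrow> nat \<Rightarrow> nat \<Rightarrow> nat \<Rightarrow> 'a::comm_semiring_1 \<Rightarrow> 'a" where
  "spec_coeff a b M i j q =
     coeff2 (P M (of_bool (a = 1) * var_x) (of_bool (a = 2) * var_x)
                 (of_bool (b = 1) * var_y) (of_bool (b = 2) * var_y) (const2 q)) i j"

lemma coeff2_add: "coeff2 (p + p') i j = coeff2 p i j + coeff2 p' i j"
  by (simp add: coeff2_def)

lemma coeff2_sum: "coeff2 (sum f A) i j = (\<Sum>x\<in>A. coeff2 (f x) i j)"
  by (simp add: coeff2_def coeff_sum)

lemma coeff2_const2_mult: "coeff2 (const2 c * p) i j = c * coeff2 p i j"
  by (simp add: coeff2_def const2_def)

lemma const2_power: "const2 c ^ n = const2 (c ^ n)"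
  by (induction n) (simp_all add: const2_def one_pCons)

lemma coeff2_0 [simp]: "coeff2 0 i j = 0"
  by (simp add: coeff2_def)

lemma coeff2_one: "coeff2 1 i j = of_bool (i = 0 \<and> j = 0)"
  by (simp add: coeff2_def coeff_pCons one_pCons split: nat.split)

lemma coeff2_var_x_mult:
  "coeff2 (var_x * p) i j = (if i = 0 then 0 else coeff2 p (i - 1) j)"
  by (cases i) (simp_all add: coeff2_def var_x_def)

lemma coeff2_var_y_mult:
  "coeff2 (var_y * p) i j = (if j = 0 then 0 else coeff2 p i (j - 1))"
  by (cases j) (simp_all add: coeff2_def var_y_def)

lemma coeff2_monomial:
  "coeff2 (var_x ^ k * (var_y ^ l * const2 c)) i j = (if i = k \<and> j = l then c else 0)"
proof (induction k arbitrary: i)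
  case 0
  show ?case
  proof (induction l arbitrary: j)
    case 0
    then show ?case
      by (simp add: coeff2_def const2_def coeff_pCons split: nat.split)
  qed (auto simp: mult.assoc coeff2_var_y_mult)
qed (auto simp: mult.assoc coeff2_var_x_mult)

text \<open>Puts the exchanged arguments produced by \<open>P_Suc\<close> back into standard form.
  With scalars 0 or 1, each partition contributes zero or a monomial, and exchanging the variables
  transposes its exponents.\<close>

lemma coeff2_P_swap:
  assumes "s \<in> {0, 1}" "t \<in> {0, 1}" "u \<in> {0, 1}" "v \<in> {0, 1}"
  shows "coeff2 (P M (s * var_y) (t * var_y) (u * var_x) (v * var_x) (const2 q)) i j =
         coeff2 (P M (s * var_x) (t * var_x) (u * var_y) (v * var_y) (const2 q)) j i"
proof -
  have scalar: "coeff2 (e * p) i j = (if e = 0 then 0 else coeff2 p i j)"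
    if "e \<in> {0, 1}" for e p :: "'a poly poly" and i j
    using that by auto
  have mult01: "x * y \<in> {0, 1}" if "x \<in> {0, 1}" "y \<in> {0, 1}" for x y :: "'a poly poly"
    using that by auto
  have power01: "x ^ n \<in> {0, 1}" if "x \<in> {0, 1}" for x :: "'a poly poly" and n
    using that by (cases n) auto
  have e: "s ^ k * t ^ l * u ^ m * v ^ n \<in> {0, 1}" for k l m n
    by (intro mult01 power01 assms)
  show ?thesis
    unfolding P_def coeff2_sum
  proof (rule sum.cong[OF refl])
    fix xs
    let ?k = "odd_count 1 xs" and ?l = "odd_count 2 xs"
      and ?m = "even_count 1 xs" and ?n = "even_count 2 xs"
    let ?e = "s ^ ?k * t ^ ?l * u ^ ?m * v ^ ?n" and ?c = "const2 (q ^ sum_list xs)"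
    \<comment> \<open>Generic \<open>z\<close> and \<open>w\<close> serve both assignments of
      \<open>var_x\<close> and \<open>var_y\<close>.\<close>
    have "(s * z) ^ ?k * (t * z) ^ ?l * (u * w) ^ ?m * (v * w) ^ ?n * const2 q ^ sum_list xs
        = ?e * (z ^ (?k + ?l) * (w ^ (?m + ?n) * ?c))" for z w
      by (simp add: power_mult_distrib power_add const2_power mult_ac)
    moreover have "coeff2 (var_y ^ (?k + ?l) * (var_x ^ (?m + ?n) * ?c)) i j =
        coeff2 (var_x ^ (?k + ?l) * (var_y ^ (?m + ?n) * ?c)) j i"
      by (subst mult.left_commute) (auto simp: coeff2_monomial)
    ultimately show "coeff2 ((s * var_y) ^ ?k * (t * var_y) ^ ?l * (u * var_x) ^ ?m *
          (v * var_x) ^ ?n * const2 q ^ sum_list xs) i j =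
        coeff2 ((s * var_x) ^ ?k * (t * var_x) ^ ?l * (u * var_y) ^ ?m *
          (v * var_y) ^ ?n * const2 q ^ sum_list xs) j i"
      by (simp only: scalar[OF e])
  qed
qed

lemma coeff2_P_swap_spec:
  "coeff2 (P M (of_bool (b = 1) * var_y) (of_bool (b = 2) * var_y)
               (of_bool (a = 1) * var_x) (of_bool (a = 2) * var_x) (const2 q)) i j =
   spec_coeff b a M j i q"
  unfolding spec_coeff_def by (rule coeff2_P_swap) auto

lemma spec_coeff_0: "spec_coeff a b 0 i j q = of_bool (i = 0 \<and> j = 0)"
  by (simp add: spec_coeff_def P_0 coeff2_one)

lemma coeff2_largest_part:
  "coeff2 (z * const2 q ^ n * p) i j = q ^ n * coeff2 (z * p) i j"
proof -
  have "z * const2 q ^ n * p = const2 (q ^ n) * (z * p)"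
    by (simp add: const2_power mult_ac)
  then show ?thesis by (simp only: coeff2_const2_mult)
qed

text \<open>A largest part divisible by 3 carries no variable, one of residue \<open>a\<close>
  carries \<open>var_x\<close> and so lowers \<open>i\<close> by one, and one of the other residue
  has weight 0.\<close>

lemma spec_coeff_Suc:
  fixes q :: "'a::comm_semiring_1"
  assumes a: "a \<in> {1, 2}"
  shows "spec_coeff a b (Suc M) i j q = spec_coeff a b M i j q +
    (if Suc M mod 3 = 0 then q ^ Suc M * spec_coeff b a M j i q
     else if Suc M mod 3 = a \<and> i \<noteq> 0
     then q ^ Suc M * spec_coeff b a (if a = 2 then M - 1 else M) j (i - 1) q
     else 0)"
proof -
  let ?c = "Suc M mod 3"
  define M' where "M' = (if ?c = 2 then M - 1 else M)"
  define z :: "'a poly poly"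
    where "z = (of_bool (a = 1) * var_x) ^ of_bool (?c = 1) * (of_bool (a = 2) * var_x) ^ of_bool (?c = 2)"
  define R where "R = P M' (of_bool (b = 1) * var_y) (of_bool (b = 2) * var_y)
    (of_bool (a = 1) * var_x) (of_bool (a = 2) * var_x) (const2 q)"
  have R: "coeff2 R i j = spec_coeff b a M' j i q" for i j
    unfolding R_def by (rule coeff2_P_swap_spec)
  \<comment> \<open>\<open>z\<close> is the variable weight of the largest part.\<close>
  have "z = (if ?c = 0 then 1 else if ?c = a then var_x else 0)"
  proof -
    have "?c \<in> {0, 1, 2}" by auto
    with a show ?thesis by (auto simp: z_def)
  qed
  then have "coeff2 (z * R) i j =
      (if ?c = 0 then spec_coeff b a M' j i q
       else if ?c = a \<and> i \<noteq> 0 then spec_coeff b a M' j (i - 1) q else 0)"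
    by (simp add: coeff2_var_x_mult R)
  moreover have "spec_coeff a b (Suc M) i j q =
      spec_coeff a b M i j q + q ^ Suc M * coeff2 (z * R) i j"
    unfolding spec_coeff_def[of a b] P_Suc coeff2_add coeff2_largest_part z_def R_def M'_def ..
  ultimately show ?thesis
    using a by (auto simp: M'_def simp del: power_Suc)
qed

lemma spec_coeff_residue_1:
  assumes "a \<in> {1, 2}"
  shows "spec_coeff a b (3 * N + 1) i j q = spec_coeff a b (3 * N) i j q +
     (if a = 1 \<and> i \<noteq> 0 then q ^ (3 * N + 1) * spec_coeff b a (3 * N) j (i - 1) q else 0)"
proof -
  have "Suc (3 * N) mod 3 = 1" by presburger
  then show ?thesis
    using spec_coeff_Suc[OF assms, of b "3 * N" i j q] by (auto simp del: power_Suc)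
qed

text \<open>The remainder is again counted at \<open>3 * N\<close>, as for residue 1, because
  \<open>3 * N + 2\<close> excludes \<open>3 * N + 1\<close>.\<close>

lemma spec_coeff_residue_2:
  assumes "a \<in> {1, 2}"
  shows "spec_coeff a b (3 * N + 2) i j q = spec_coeff a b (3 * N + 1) i j q +
     (if a = 2 \<and> i \<noteq> 0 then q ^ (3 * N + 2) * spec_coeff b a (3 * N) j (i - 1) q else 0)"
proof -
  have "Suc (3 * N + 1) mod 3 = 2" by presburger
  then show ?thesis
    using spec_coeff_Suc[OF assms, of b "3 * N + 1" i j q] by (auto simp del: power_Suc)
qed

lemma spec_coeff_residue_0:
  assumes "a \<in> {1, 2}"
  shows "spec_coeff a b (3 * Suc N) i j q = spec_coeff a b (3 * N + 2) i j q +
     q ^ (3 * N + 3) * spec_coeff b a (3 * N + 2) j i q"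
proof -
  have "Suc (3 * N + 2) mod 3 = 0" "3 * Suc N = Suc (3 * N + 2)" "3 * N + 3 = Suc (3 * N + 2)"
    by presburger+
  then show ?thesis
    using spec_coeff_Suc[OF assms, of b "3 * N + 2" i j q] by (simp only: refl if_True)
qed

section \<open>The identities for \<open>F\<close> and \<open>G\<close>\<close>

lemma qpoch_0 [simp]: "qpoch x q 0 = 1"
  by (simp add: qpoch_def)

lemma qpoch_Suc: "qpoch x q (Suc n) = qpoch x q n * (1 - x * q ^ n)"
  by (simp add: qpoch_def)

lemma F_eq_0: "N < i + j \<Longrightarrow> F N i j q = 0"
  by (simp add: F_def qmultinomial_def)

lemma F_commute: "F N i j q = F N j i q"
  by (auto simp: F_def qmultinomial_def algebra_simps)

text \<open>Writing the upper index as \<open>i + j + n\<close> removes the integer subtractions and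
  the case distinction from \<open>F\<close>.\<close>

lemma F_add:
  "F (i + j + n) i j q =
     qpoch (q ^ 6) (q ^ 6) (i + j + n) * qpoch (- (q ^ 3)) (q ^ 3) n /
     (qpoch (q ^ 6) (q ^ 6) i * qpoch (q ^ 6) (q ^ 6) j * qpoch (q ^ 6) (q ^ 6) n)"
  by (simp add: F_def qmultinomial_def mult.assoc)

lemma F_0: "F 0 i j q = of_bool (i = 0 \<and> j = 0)"
  using F_add[of 0 0 0 q] F_eq_0[of 0 i j q] by auto

lemma qpoch_q6_Suc:
  "qpoch (q ^ 6) (q ^ 6) (Suc n) = qpoch (q ^ 6) (q ^ 6) n * (1 - q ^ (6 * Suc n))"
  by (simp add: qpoch_Suc power_mult power_add flip: power_mult)

lemma qpoch_neg_q3_Suc: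
  "qpoch (- (q ^ 3)) (q ^ 3) (Suc n) = qpoch (- (q ^ 3)) (q ^ 3) n * (1 + q ^ (3 * Suc n))"
  by (simp add: qpoch_Suc power_mult power_add flip: power_mult)

definition spec_exp :: "nat \<Rightarrow> nat \<Rightarrow> nat \<Rightarrow> nat \<Rightarrow> int" where
  "spec_exp a b i j =
     (3 * int i - 3 + int a) * int i + (3 * int j + int b) * int j"

text \<open>These hypotheses make the denominators \<open>1 - q ^ n\<close> with
  \<open>n > 0\<close> nonzero and integer powers of \<open>q\<close> additive.\<close>

context
  fixes q :: "'a::field"
  assumes not_root_of_unity: "\<And>n. n > 0 \<Longrightarrow> q ^ n \<noteq> 1" and q_nonzero: "q \<noteq> 0"
begin

text \<open>\<open>F\<close> is symmetric in \<open>i, j\<close>, and the powers \<open>x, y\<close>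
  in the two numerators satisfy \<open>x * y = q ^ (6 * (N + 1))\<close>. Hence
  \<open>(1 - x) + x * (1 - y) = 1 - x * y\<close> cancels the denominator.\<close>

lemma F_Suc_eq_G:
  "F (Suc N) i j q = G N i j q + q powi (3 * (int N + 1 + int i - int j)) * G N j i q"
proof -
  define x where "x = q powi (3 * (int N + 1 + int i - int j))"
  define y where "y = q powi (3 * (int N + 1 + int j - int i))"
  have "x * y = q powi int (6 * (N + 1))"
    unfolding x_def y_def power_int_add[OF disjI1[OF q_nonzero], symmetric]
    by (rule arg_cong[of _ _ "(powi) q"]) simp
  then have xy: "x * y = q ^ (6 * (N + 1))" by (simp only: power_int_of_nat)
  have ne: "1 - q ^ (6 * (N + 1)) \<noteq> 0"
    using not_root_of_unity[of "6 * (N + 1)"] by simp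
  have "G N i j q + x * G N j i q =
      ((1 - x) + x * (1 - y)) / (1 - q ^ (6 * (N + 1))) * F (Suc N) i j q"
  proof -
    have "(1 - x) / d * f + x * ((1 - y) / d * f) = ((1 - x) + x * (1 - y)) / d * f" for d f
      by (simp add: add_divide_distrib diff_divide_distrib algebra_simps)
    then show ?thesis
      unfolding G_def F_commute[of "N + 1" j i] x_def[symmetric] y_def[symmetric]
      by (simp only: Suc_eq_plus1)
  qed
  also have "(1 - x) + x * (1 - y) = 1 - q ^ (6 * (N + 1))"
    by (simp only: xy[symmetric]) (simp add: algebra_simps)
  finally show ?thesis using ne by (simp add: x_def)
qed

text \<open>For \<open>i + j \<le> N\<close> all terms share a factor \<open>?K * (1 + y)\<close>,
  leaving \<open>1 - x * y = (1 - y) + y * (1 - x)\<close>. On the boundary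
  \<open>i + j = N + 1\<close> the term \<open>F N i j q\<close> vanishes, and beyond it everything
  does.\<close>

lemma G_eq_F:
  "G N i j q = F N i j q +
     (if i = 0 then 0 else q powi (3 * (int N + 1 - int i - int j)) * F N j (i - 1) q)"
proof -
  let ?p = "qpoch (q ^ 6) (q ^ 6)" and ?c = "qpoch (- (q ^ 3)) (q ^ 3)"
  have ne: "1 - q ^ (6 * Suc n) \<noteq> 0" for n
    using not_root_of_unity[of "6 * Suc n"] by simp
  consider (gt) "i + j > N + 1" | (eq) "i + j = N + 1" | (le) "i + j \<le> N" by linarith
  then show ?thesis
  proof cases
    case gt
    then show ?thesis by (auto simp: G_def F_eq_0)
  next
    case eq
    show ?thesis
    proof (cases i)
      case 0
      \<comment> \<open>Here \<open>j = N + 1\<close>, so the numerator of \<open>G\<close> is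
        \<open>1 - q powi 0 = 0\<close>.\<close>
      with eq show ?thesis by (simp add: G_def F_eq_0)
    next
      case (Suc k)
      with eq have N: "N = k + j" by simp
      \<comment> \<open>Since \<open>i + j = N + 1\<close>, the exponent is \<open>6 * i\<close>;
        the numerator of \<open>G\<close> cancels the last factor of \<open>?p i\<close>.\<close>
      have "q powi (3 * (int N + 1 + int i - int j)) = q powi int (6 * Suc k)"
        by (rule arg_cong[of _ _ "(powi) q"]) (simp add: N Suc)
      then have pw: "q powi (3 * (int N + 1 + int i - int j)) = q ^ (6 * Suc k)"
        by (simp only: power_int_of_nat)
      have F1: "F (N + 1) i j q = ?p N * (1 - q ^ (6 * (N + 1))) / (?p k * (1 - q ^ (6 * Suc k)) * ?p j)"
        using F_add[of "Suc k" j 0 q] by (simp add: N Suc qpoch_q6_Suc del: mult_Suc_right)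
      have F2: "F N j k q = ?p N / (?p k * ?p j)"
        using F_add[of j k 0 q] by (simp add: N add.commute mult.commute)
      have "G N i j q = F N j k q"
      proof -
        have "e / d * (x * d / (y * e * z)) = x / (y * z)" if "d \<noteq> 0" "e \<noteq> 0" for d e x y z :: 'a
          using that by simp
        then show ?thesis
          unfolding G_def pw F1 F2 using ne[of N] ne[of k] by (simp only: Suc_eq_plus1 not_False_eq_True)
      qed
      then show ?thesis by (simp add: F_eq_0 N Suc)
    qed
  next
    case le
    then obtain n where N: "N = i + j + n" by (metis le_iff_add)
    \<comment> \<open>Since \<open>N + 1 + i - j = 2 * i + (n + 1)\<close>, the power in the
      numerator of \<open>G\<close> is \<open>x * y\<close>.\<close>
    define y where "y = q ^ (3 * Suc n)"
    define x where "x = q ^ (6 * i)"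
    have "q powi (3 * (int N + 1 + int i - int j)) = q powi int (6 * i + 3 * Suc n)"
      by (rule arg_cong[of _ _ "(powi) q"]) (simp add: N)
    then have pw: "q powi (3 * (int N + 1 + int i - int j)) = x * y"
      unfolding x_def y_def by (simp only: power_int_of_nat power_add)
    have "q powi (3 * (int N + 1 - int i - int j)) = q powi int (3 * Suc n)"
      by (rule arg_cong[of _ _ "(powi) q"]) (simp add: N)
    then have pw': "q powi (3 * (int N + 1 - int i - int j)) = y"
      unfolding y_def by (simp only: power_int_of_nat)
    have yy: "q ^ (6 * Suc n) = y * y"
      by (simp add: y_def flip: power_add)
    have ne_y: "1 - y * y \<noteq> 0" using ne[of n] yy by simp
    let ?K = "?p N * ?c n / (?p i * ?p j * ?p n * (1 - y * y))"
    have p_Suc: "?p (Suc n) = ?p n * (1 - y * y)" and c_Suc: "?c (Suc n) = ?c n * (1 + y)"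
      by (simp_all only: qpoch_q6_Suc qpoch_neg_q3_Suc yy y_def)
    have "F (N + 1) i j q = ?p (N + 1) * ?c (Suc n) / (?p i * ?p j * ?p (Suc n))"
      using F_add[of i j "Suc n" q] by (simp add: N)
    also have "?p (N + 1) = ?p N * (1 - q ^ (6 * (N + 1)))"
      by (simp only: qpoch_q6_Suc flip: Suc_eq_plus1)
    finally have F1: "F (N + 1) i j q = ?K * (1 - q ^ (6 * (N + 1))) * (1 + y)"
      unfolding p_Suc c_Suc by (simp add: mult_ac)
    have F2: "F N i j q = ?K * (1 - y * y)"
      using F_add[of i j n q] ne_y by (simp add: N)
    \<comment> \<open>For \<open>i = 0\<close> the right side vanishes because \<open>x = 1\<close>.
      Otherwise the third index of the multinomial is \<open>n + 1\<close>, and \<open>1 - x\<close>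
      is the last factor of \<open>?p i\<close>.\<close>
    have F3: "(if i = 0 then 0 else y * F N j (i - 1) q) = ?K * (1 + y) * (y * (1 - x))"
    proof (cases i)
      case 0
      then show ?thesis by (simp add: x_def)
    next
      case (Suc k)
      have "F N j k q = ?p N * (?c n * (1 + y)) / (?p j * ?p k * (?p n * (1 - y * y)))"
        using F_add[of j k "Suc n" q]
        by (simp only: p_Suc c_Suc) (simp add: N Suc add_ac)
      moreover have "?p i = ?p k * (1 - x)" "1 - x \<noteq> 0"
        using ne[of k] by (simp_all only: Suc x_def qpoch_q6_Suc not_False_eq_True)
      ultimately show ?thesis
        using Suc by (simp add: mult_ac)
    qed
    have "G N i j q = ?K * (1 + y) * (1 - x * y)"
      unfolding G_def pw F1 using ne[of N] by (simp add: mult_ac)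
    also have "\<dots> = ?K * (1 - y * y) + ?K * (1 + y) * (y * (1 - x))"
      by (simp only: ring_distribs mult_ac) (simp add: algebra_simps)
    finally show ?thesis by (simp only: F2 F3 pw')
  qed
qed

section \<open>Exponent bookkeeping and induction on \<open>N\<close>\<close>

text \<open>Balances the exponents when the part \<open>3 * N + a\<close> is removed. The comparison
  is made in the integers, since \<open>N + 1 - i - j\<close> may be negative.\<close>

lemma spec_exp_pred:
  assumes "i \<noteq> 0"
  shows "q ^ (3 * N + a) * q powi spec_exp b a j (i - 1) =
         q powi spec_exp a b i j * q powi (3 * (int N + 1 - int i - int j))"
proof -
  obtain k where k: "i = Suc k" using assms by (cases i) auto
  have "int (3 * N + a) + spec_exp b a j (i - 1) =
      spec_exp a b i j + 3 * (int N + 1 - int i - int j)"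
    by (simp add: spec_exp_def k algebra_simps)
  from arg_cong[of _ _ "(powi) q", OF this] show ?thesis
    by (simp only: power_int_add[OF disjI1[OF q_nonzero]] power_int_of_nat)
qed

lemma spec_exp_swap:
  "q ^ (3 * N + 3) * q powi spec_exp b a j i =
     q powi spec_exp a b i j * q powi (3 * (int N + 1 + int i - int j))"
proof -
  have "int (3 * N + 3) + spec_exp b a j i =
      spec_exp a b i j + 3 * (int N + 1 + int i - int j)"
    by (simp add: spec_exp_def algebra_simps)
  from arg_cong[of _ _ "(powi) q", OF this] show ?thesis
    by (simp only: power_int_add[OF disjI1[OF q_nonzero]] power_int_of_nat)
qed

lemma spec_coeff_F_imp_G:
  assumes IH: "\<And>a b i j. a \<in> {1, 2} \<Longrightarrow> b \<in> {1, 2} \<Longrightarrow>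
      spec_coeff a b (3 * N) i j q = q powi spec_exp a b i j * F N i j q"
    and ab: "a \<in> {1, 2}" "b \<in> {1, 2}"
  shows "spec_coeff a b (3 * N) i j q +
      (if i \<noteq> 0 then q ^ (3 * N + a) * spec_coeff b a (3 * N) j (i - 1) q else 0) =
    q powi spec_exp a b i j * G N i j q"
proof (cases "i = 0")
  case True
  then show ?thesis by (simp add: IH[OF ab] G_eq_F)
next
  case False
  let ?w = "q powi (3 * (int N + 1 - int i - int j))"
  have "q ^ (3 * N + a) * (q powi spec_exp b a j (i - 1) * F N j (i - 1) q) =
      q powi spec_exp a b i j * (?w * F N j (i - 1) q)"
    by (simp only: mult.assoc[symmetric] spec_exp_pred[OF False])
  with False show ?thesis
    by (simp only: IH[OF ab] IH[OF ab(2,1)] G_eq_F if_True if_False simp_thms distrib_left)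
qed

text \<open>The induction passes from \<open>3 * N\<close> through \<open>3 * N + 2\<close>, where
  \<open>G\<close> appears for either \<open>a\<close>, to \<open>3 * N + 3\<close>, where
  \<open>F_Suc_eq_G\<close> restores \<open>F\<close>.\<close>

lemma spec_coeff_F:
  assumes "a \<in> {1, 2}" "b \<in> {1, 2}"
  shows "spec_coeff a b (3 * N) i j q = q powi spec_exp a b i j * F N i j q"
  using assms
proof (induction N arbitrary: a b i j)
  case 0
  show ?case by (cases "i = 0 \<and> j = 0") (auto simp: spec_coeff_0 F_0 spec_exp_def)
next
  case (Suc N)
  \<comment> \<open>Needed for all indices: the part \<open>3 * N + 3\<close> brings in
    \<open>(b, a)\<close> and \<open>(j, i)\<close>.\<close>
  have G: "spec_coeff a b (3 * N + 2) i j q = q powi spec_exp a b i j * G N i j q"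
    if "a \<in> {1, 2}" "b \<in> {1, 2}" for a b i j
    using spec_coeff_F_imp_G[OF Suc.IH that, of i j] that
    unfolding spec_coeff_residue_2[OF that(1)] spec_coeff_residue_1[OF that(1)] by auto
  show ?case
    unfolding spec_coeff_residue_0[OF Suc.prems(1)] F_Suc_eq_G using Suc.prems
    by (simp only: G distrib_left mult.assoc[symmetric] spec_exp_swap)
qed

text \<open>The change from \<open>F\<close> to \<open>G\<close> happens exactly when
  \<open>3 * N + a\<close> becomes available, that is for \<open>a \<le> \<mu>\<close>; a part of
  the other residue adds nothing.\<close>

lemma spec_coeff_eq:
  assumes "a \<in> {1, 2}" "b \<in> {1, 2}" "\<mu> \<in> {0, 1, 2}"
  shows "spec_coeff a b (3 * N + \<mu>) i j q =
    q powi spec_exp a b i j * (if a \<le> \<mu> then G N i j q else F N i j q)"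
proof -
  let ?E = "q powi spec_exp a b i j"
  note F = spec_coeff_F[OF assms(1,2), of N i j]
  have G: "spec_coeff a b (3 * N) i j q +
      (if i \<noteq> 0 then q ^ (3 * N + a) * spec_coeff b a (3 * N) j (i - 1) q else 0) = ?E * G N i j q"
    by (rule spec_coeff_F_imp_G[OF spec_coeff_F assms(1,2)])
  note residue_1 = spec_coeff_residue_1[OF assms(1), of b N i j q]
  note residue_2 = spec_coeff_residue_2[OF assms(1), of b N i j q]
  show ?thesis
  proof (cases "a = 1")
    case True
    have 1: "spec_coeff a b (3 * N + 1) i j q = ?E * G N i j q"
      unfolding residue_1 G[symmetric] by (simp only: True simp_thms)
    have "spec_coeff a b (3 * N + 2) i j q = ?E * G N i j q"
      unfolding residue_2 1 by (simp add: True)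
    with 1 F True assms(3) show ?thesis
      by (elim insertE emptyE) simp_all
  next
    case False
    with assms(1) have a: "a = 2" by simp
    have 1: "spec_coeff a b (3 * N + 1) i j q = ?E * F N i j q"
      unfolding residue_1 F by (simp add: a)
    have "spec_coeff a b (3 * N + 2) i j q = ?E * G N i j q"
      unfolding residue_2 1 G[symmetric] F by (simp only: a simp_thms)
    with 1 F a assms(3) show ?thesis
      by (elim insertE emptyE) simp_all
  qed
qed

end

section \<open>The indeterminate \<open>q\<close> and the four cases\<close>

lemma qvar_power: "qvar ^ n = Fract (monom 1 n) 1"
  by (induction n) (simp_all add: qvar_def One_fract_def monom_Suc)

lemma qvar_power_neq_1: "n > 0 \<Longrightarrow> qvar ^ n \<noteq> 1"
  by (simp add: qvar_power One_fract_def eq_fract monom_eq_1_iff)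

lemma qvar_nonzero: "qvar \<noteq> 0"
  by (simp add: qvar_def Zero_fract_def eq_fract)

theorem theorem3p11:
  fixes N i j \<mu> :: nat
  assumes "i \<le> N" and "j \<le> N" and "\<mu> \<in> {0, 1, 2}"
  shows
        "coeff2 (P (3 * N + \<mu>) 0 var_x var_y 0 (const2 qvar)) i j =
           qvar powi omega 1 i j *
             ((of_bool (\<mu> = 0) + of_bool (\<mu> = 1)) * F N i j qvar + of_bool (\<mu> = 2) * G N i j qvar) \<and>
         coeff2 (P (3 * N + \<mu>) var_x 0 0 var_y (const2 qvar)) i j =
           qvar powi omega 2 i j *
             (of_bool (\<mu> = 0) * F N i j qvar + (of_bool (\<mu> = 1) + of_bool (\<mu> = 2)) * G N i j qvar) \<and>
         coeff2 (P (3 * N + \<mu>) var_x 0 var_y 0 (const2 qvar)) i j =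
           qvar powi pi_exp 1 i j *
             (of_bool (\<mu> = 0) * F N i j qvar + (of_bool (\<mu> = 1) + of_bool (\<mu> = 2)) * G N i j qvar) \<and>
         coeff2 (P (3 * N + \<mu>) 0 var_x 0 var_y (const2 qvar)) i j =
           qvar powi pi_exp 2 i j *
             ((of_bool (\<mu> = 0) + of_bool (\<mu> = 1)) * F N i j qvar + of_bool (\<mu> = 2) * G N i j qvar)"
proof -
  note eq = spec_coeff_eq[OF qvar_power_neq_1 qvar_nonzero _ _ assms(3), unfolded spec_coeff_def]
  \<comment> \<open>The pairs \<open>(a, b)\<close> are the residues allowed at odd and even indices
    in the four specializations.\<close>
  have exps: "omega 1 i j = spec_exp 2 1 i j" "omega 2 i j = spec_exp 1 2 i j"
    "pi_exp 1 i j = spec_exp 1 1 i j" "pi_exp 2 i j = spec_exp 2 2 i j"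
    by (simp_all add: omega_def pi_exp_def spec_exp_def algebra_simps)
  show ?thesis
    unfolding exps
    using eq[of 2 1 N i j] eq[of 1 2 N i j] eq[of 1 1 N i j] eq[of 2 2 N i j] assms(3)
    by auto
qed

end
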